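(* Every nonshellable $2$-dimensional simplicial complex has a nonshellable induced subcomplex with $n$ vertices for some $n$ with $4\le n\le 7$.
   Context: All simplicial complexes are finite (abstract) and contain the empty face; if $K$ is a simplicial complex on vertex set $V$, then $\{v\}\in K$ for every $v\in V$. Facets are the inclusion-maximal faces; $\dim F=|F|-1$. A complex is pure if all its facets have the same dimension. For $U\subseteq V$, the induced subcomplex $K(U)$ is $\{F\in K: F\subseteq U\}$ (possibly $U=V$). Shellability means (not necessarily pure) shellability: $K$ is shellable if its facets can be ordered $F_1,\dots,F_t$ so that for each $k=2,\dots,t$ the complex $\left(\bigcup_{i=1}^{k-1}\bar F_i\right)\cap \bar F_k$ is pure of dimension $\dim F_k-1$, where $\bar F$ denotes the simplex consisting of all subsets of $F$. *)

theory Defs imports Main begin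

definition simplicial_complex :: "'a set \<Rightarrow> 'a set set \<Rightarrow> bool" where
  "simplicial_complex V K \<longleftrightarrow>
     finite V \<and> K \<subseteq> Pow V \<and> {} \<in> K \<and> (\<forall>v\<in>V. {v} \<in> K) \<and>
     (\<forall>F\<in>K. \<forall>G. G \<subseteq> F \<longrightarrow> G \<in> K)"

(* Integer-valued, so that the empty face has dimension -1. *)
definition face_dim :: "'a set \<Rightarrow> int" where
  "face_dim F = int (card F) - 1"

definition complex_dim :: "'a set set \<Rightarrow> int" where
  "complex_dim K = Max (face_dim ` K)"

definition facets :: "'a set set \<Rightarrow> 'a set set" where
  "facets K = {F \<in> K. \<forall>G\<in>K. F \<subseteq> G \<longrightarrow> G = F}"

definition pure_complex :: "'a set set \<Rightarrow> bool" where
  "pure_complex K \<longleftrightarrow> (\<forall>F\<in>facets K. \<forall>G\<in>facets K. face_dim F = face_dim G)"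

definition induced_subcomplex :: "'a set set \<Rightarrow> 'a set \<Rightarrow> 'a set set" where
  "induced_subcomplex K U = {F \<in> K. F \<subseteq> U}"

(* Not necessarily pure shellability. List positions start at 0, so the position k
   below ranges over all facets of the ordering except the first. *)
definition shelling :: "'a set set \<Rightarrow> 'a set list \<Rightarrow> bool" where
  "shelling K Fs \<longleftrightarrow>
     distinct Fs \<and> set Fs = facets K \<and>
     (\<forall>k. 1 \<le> k \<and> k < length Fs \<longrightarrow>
        (let L = (\<Union>i<k. Pow (Fs ! i)) \<inter> Pow (Fs ! k)
         in pure_complex L \<and> complex_dim L = face_dim (Fs ! k) - 1))"

definition shellable :: "'a set set \<Rightarrow> bool" where
  "shellable K \<longleftrightarrow> (\<exists>Fs. shelling K Fs)"

end

theory Submission imports Defs begin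

text \<open>
  The facets of a complex of dimension at most 2 can be shelled in the order triangles, edges,
  vertices. The edges cause a problem only if the graph of the complex contains two disjoint edges
  that span no further edge, which is a nonshellable induced subcomplex on 4 vertices. So it
  remains to show that a set T of triangles is shellable if T[U] is for all U with at most 7
  vertices. Remove a vertex v; by induction, the set T - v of triangles avoiding v is shellable.
  Let N be the set of edges of the link of v that lie in a triangle avoiding v. If N is connected,
  then T is shelled by T - v, followed by the cones over N, followed by the other triangles
  (links are connected, since they contain no two disjoint edges spanning no further edge).
  If N is not connected, the link of v contains a path a, x, y, b with ax and yb in different
  components of N and xy in no triangle but vxy. With triangles axp and byq avoiding v, the set
  U = {v, x, y, a, b, p, q} is bad: if T[U - v] is connected, then the component of ax in N defines
  a 1-cocycle modulo 2 of T[U] that is not a coboundary, whereas a shellable complex has no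
  1-cohomology.
\<close>

section \<open>Shellability as an inductive property of sets of facets\<close>

text \<open>The shelling condition for a new facet, with the complex of shared faces eliminated:
  each face that \<open>F\<close> shares with \<open>P\<close> lies in a shared face of codimension
  one. It is vacuous for \<open>P = {}\<close>, so a first facet needs no special treatment.\<close>

definition attaches :: "'a set set \<Rightarrow> 'a set \<Rightarrow> bool" where
  "attaches P F \<longleftrightarrow> (\<forall>G\<in>P. \<exists>G'\<in>P. G \<inter> F \<subseteq> G' \<and> Suc (card (G' \<inter> F)) = card F)"

text \<open>Whether a facet may be added depends only on the set already placed, so the order
  survives only in the derivation.\<close>

inductive shellable_set :: "'a set set \<Rightarrow> bool" where
  empty: "shellable_set {}"
| insert: "shellable_set P \<Longrightarrow> F \<notin> P \<Longrightarrow> attaches P F \<Longrightarrow> shellable_set (insert F P)"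

text \<open>Left to right: a face of largest size is a facet of \<open>L\<close>, so purity gives
  every facet of \<open>L\<close> one element less than \<open>F\<close>, and a facet of
  \<open>L\<close> above \<open>G \<inter> F\<close> has the form \<open>G' \<inter> F\<close>.
  Right to left: every face of \<open>L\<close> extends to one of that size, so no facet is smaller
  and no face is larger.\<close>

lemma attaches_iff:
  assumes fin: "finite F" and P: "P \<noteq> {}" and max: "\<And>G. G \<in> P \<Longrightarrow> \<not> F \<subseteq> G"
  defines "L \<equiv> (\<Union>G\<in>P. Pow G) \<inter> Pow F"
  shows "pure_complex L \<and> complex_dim L = face_dim F - 1 \<longleftrightarrow> attaches P F"
proof -
  have finL: "finite L" unfolding L_def using fin by simp
  have neL: "L \<noteq> {}" unfolding L_def using P by auto
  have "attaches P F" if L: "pure_complex L \<and> complex_dim L = face_dim F - 1"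
  proof -
    have "complex_dim L \<in> face_dim ` L" unfolding complex_dim_def using finL neL by simp
    then obtain M where M: "M \<in> L" "complex_dim L = face_dim M" by auto
    have "G = M" if G: "G \<in> L" "M \<subseteq> G" for G
    proof -
      have "face_dim G \<le> face_dim M" unfolding M(2)[symmetric] complex_dim_def using finL G by simp
      hence "card G \<le> card M" by (simp add: face_dim_def)
      moreover have "finite G" using G fin unfolding L_def by (auto intro: finite_subset)
      ultimately show ?thesis using G(2) card_seteq by blast
    qed
    hence "M \<in> facets L" using M by (auto simp: facets_def)
    show ?thesis
      unfolding attaches_def
    proof
      fix G assume "G \<in> P"
      hence "G \<inter> F \<in> L" unfolding L_def by auto
      then obtain E where E: "E \<in> L" "G \<inter> F \<subseteq> E" "\<And>E'. E' \<in> L \<Longrightarrow> E \<subseteq> E' \<Longrightarrow> E' = E"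
        using finite_has_maximal2[OF finL] by metis
      have "E \<in> facets L" using E by (auto simp: facets_def)
      hence "face_dim E = face_dim M" using L \<open>M \<in> facets L\<close> unfolding pure_complex_def by blast
      hence cE: "Suc (card E) = card F" using L M(2) by (simp add: face_dim_def)
      obtain G' where G': "G' \<in> P" "E \<subseteq> G'" "E \<subseteq> F" using E(1) unfolding L_def by auto
      have "G' \<inter> F \<in> L" using G' unfolding L_def by auto
      hence "G' \<inter> F = E" using E(3) G' by blast
      thus "\<exists>G'\<in>P. G \<inter> F \<subseteq> G' \<and> Suc (card (G' \<inter> F)) = card F" using G' E(2) cE by auto
    qed
  qed
  moreover have "pure_complex L \<and> complex_dim L = face_dim F - 1" if A: "attaches P F"
  proof -
    have ex: "\<exists>E'\<in>L. E \<subseteq> E' \<and> Suc (card E') = card F" if E: "E \<in> L" for E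
    proof -
      obtain G where G: "G \<in> P" "E \<subseteq> G" "E \<subseteq> F" using E unfolding L_def by auto
      then obtain G' where "G' \<in> P" "G \<inter> F \<subseteq> G'" "Suc (card (G' \<inter> F)) = card F"
        using A unfolding attaches_def by blast
      thus ?thesis using G unfolding L_def by (intro bexI[of _ "G' \<inter> F"]) auto
    qed
    have dimF: "face_dim E = face_dim F - 1" if "E \<in> facets L" for E
    proof -
      have "E \<in> L" using that by (simp add: facets_def)
      then obtain E' where E': "E' \<in> L" "E \<subseteq> E'" "Suc (card E') = card F" using ex by blast
      with that have "E' = E" by (auto simp: facets_def)
      with E' show ?thesis by (simp add: face_dim_def)
    qed
    have "complex_dim L = face_dim F - 1"
      unfolding complex_dim_def
    proof (rule Max_eqI)
      show "finite (face_dim ` L)" using finL by simp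
    next
      fix y assume "y \<in> face_dim ` L"
      then obtain E where E: "E \<in> L" "y = face_dim E" by auto
      then obtain E' where E': "E' \<in> L" "E \<subseteq> E'" "Suc (card E') = card F" using ex by blast
      have "finite E'" using E' fin unfolding L_def by (auto intro: finite_subset)
      hence "card E \<le> card E'" using E' card_mono by blast
      thus "y \<le> face_dim F - 1" using E E' by (simp add: face_dim_def)
    next
      obtain E where "E \<in> L" using neL by blast
      then obtain E' where "E' \<in> L" "Suc (card E') = card F" using ex by blast
      thus "face_dim F - 1 \<in> face_dim ` L" by (intro image_eqI[of _ _ E']) (auto simp: face_dim_def)
    qed
    thus ?thesis
      using dimF unfolding pure_complex_def by simp
  qed
  ultimately show ?thesis by blast
qed

lemma facets_not_subset: "F \<in> facets K \<Longrightarrow> G \<in> facets K \<Longrightarrow> F \<noteq> G \<Longrightarrow> \<not> F \<subseteq> G"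
  by (auto simp: facets_def)

lemma simplicial_complex_finite:
  assumes "simplicial_complex V K"
  shows "finite V" "finite K" "F \<in> K \<Longrightarrow> finite F"
  using assms unfolding simplicial_complex_def
  by (auto intro: finite_subset[of K "Pow V"] finite_subset[of F V])

lemma UN_nth_take: "k \<le> length Fs \<Longrightarrow> (\<Union>i<k. Pow (Fs ! i)) = (\<Union>G\<in>set (take k Fs). Pow G)"
  by (simp add: nth_image[symmetric] lessThan_atLeast0)

lemma shellable_iff_shellable_set:
  assumes K: "simplicial_complex V K"
  shows "shellable K \<longleftrightarrow> shellable_set (facets K)"
proof
  assume "shellable K"
  then obtain Fs where Fs: "shelling K Fs" unfolding shellable_def by blast
  hence dis: "distinct Fs" and set: "set Fs = facets K" by (auto simp: shelling_def)
  have "shellable_set (set (take k Fs))" if "k \<le> length Fs" for k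
    using that
  proof (induction k)
    case 0
    show ?case by (simp add: shellable_set.empty)
  next
    case (Suc k)
    let ?F = "Fs ! k" and ?P = "set (take k Fs)"
    have k: "k < length Fs" using Suc by simp
    have F: "?F \<in> facets K" using k set nth_mem by blast
    have notin: "?F \<notin> ?P" using dis k by (auto simp: in_set_conv_nth nth_eq_iff_index_eq)
    have P: "?P \<subseteq> facets K" using set set_take_subset by metis
    \<comment> \<open>The definition of \<open>shelling\<close> is silent about position 0, where
      \<open>attaches\<close> is vacuous.\<close>
    have "attaches ?P ?F"
    proof (cases "k = 0")
      case True
      thus ?thesis by (simp add: attaches_def)
    next
      case False
      show ?thesis
      proof (rule attaches_iff[THEN iffD1])
        show "finite ?F" using F simplicial_complex_finite(3)[OF K] by (simp add: facets_def)
        show "?P \<noteq> {}" using False k by auto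
        show "\<not> ?F \<subseteq> G" if "G \<in> ?P" for G
          using that P F notin facets_not_subset by (metis subset_iff)
        have "1 \<le> k" using False by simp
        thus "pure_complex ((\<Union>G\<in>?P. Pow G) \<inter> Pow ?F) \<and>
          complex_dim ((\<Union>G\<in>?P. Pow G) \<inter> Pow ?F) = face_dim ?F - 1"
          using Fs k unfolding shelling_def Let_def by (simp add: UN_nth_take[symmetric])
      qed
    qed
    hence "shellable_set (insert ?F ?P)" using Suc notin k by (intro shellable_set.insert) auto
    thus ?case using k by (simp add: take_Suc_conv_app_nth)
  qed
  from this[of "length Fs"] show "shellable_set (facets K)" using set by simp
next
  assume "shellable_set (facets K)"
  \<comment> \<open>Generalized from \<open>facets K\<close> to its subsets, so that rule induction
    applies; each inserted facet is appended to the list.\<close>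
  have "\<exists>Fs. distinct Fs \<and> set Fs = P \<and>
     (\<forall>k. 1 \<le> k \<and> k < length Fs \<longrightarrow>
        (let L = (\<Union>i<k. Pow (Fs ! i)) \<inter> Pow (Fs ! k)
         in pure_complex L \<and> complex_dim L = face_dim (Fs ! k) - 1))"
    if "shellable_set P" "P \<subseteq> facets K" for P
    using that
  proof (induction rule: shellable_set.induct)
    case empty
    show ?case by (intro exI[of _ "[]"]) simp
  next
    case (insert P F)
    then obtain Fs where Fs: "distinct Fs" "set Fs = P"
      "\<And>k. 1 \<le> k \<Longrightarrow> k < length Fs \<Longrightarrow>
        (let L = (\<Union>i<k. Pow (Fs ! i)) \<inter> Pow (Fs ! k)
         in pure_complex L \<and> complex_dim L = face_dim (Fs ! k) - 1)"
      by auto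
    show ?case
    proof (intro exI[of _ "Fs @ [F]"] conjI allI impI)
      show "distinct (Fs @ [F])" "set (Fs @ [F]) = insert F P" using Fs insert by auto
    next
      fix k assume k: "1 \<le> k \<and> k < length (Fs @ [F])"
      have U: "(\<Union>i<k. Pow ((Fs @ [F]) ! i)) = (\<Union>i<k. Pow (Fs ! i))"
        using k by (intro SUP_cong) (auto simp: nth_append)
      show "let L = (\<Union>i<k. Pow ((Fs @ [F]) ! i)) \<inter> Pow ((Fs @ [F]) ! k)
         in pure_complex L \<and> complex_dim L = face_dim ((Fs @ [F]) ! k) - 1"
      proof (cases "k < length Fs")
        case True
        thus ?thesis using Fs(3)[of k] k unfolding U by (simp add: nth_append)
      next
        case False
        hence [simp]: "k = length Fs" using k by simp
        have "finite F" using insert.prems simplicial_complex_finite(3)[OF K] by (simp add: facets_def)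
        moreover have "P \<noteq> {}" using k Fs(2) by auto
        moreover have "\<not> F \<subseteq> G" if "G \<in> P" for G
          using that insert.prems insert.hyps facets_not_subset by (metis insert_subset subset_iff)
        ultimately show ?thesis
          using attaches_iff[of F P] insert.hyps unfolding U Let_def UN_nth_take[OF order.refl]
          by (simp add: UN_nth_take Fs(2))
      qed
    qed
  qed
  from this[of "facets K"] \<open>shellable_set (facets K)\<close> show "shellable K"
    unfolding shellable_def shelling_def by blast
qed

text \<open>Greedy construction: if no shellable intermediate stage is stuck, all of
  \<open>Q\<close> can be added. Later proofs need only exhibit one next facet and never write down
  an order.\<close>

lemma shellable_set_extend:
  assumes "finite Q" "shellable_set P"
    and "\<And>S. shellable_set S \<Longrightarrow> P \<subseteq> S \<Longrightarrow> S \<subset> P \<union> Q \<Longrightarrow> \<exists>F\<in>P \<union> Q - S. attaches S F"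
  shows "shellable_set (P \<union> Q)"
  using assms
proof (induction "card (Q - P)" arbitrary: P)
  case 0
  hence "P \<union> Q = P" by auto
  thus ?case using 0 by simp
next
  case (Suc n)
  have "Q - P \<noteq> {}" using Suc.hyps(2) by (metis card.empty nat.distinct(1))
  hence "P \<subset> P \<union> Q" by auto
  then obtain F where F: "F \<in> P \<union> Q - P" "attaches P F" using Suc.prems by blast
  have eq: "insert F P \<union> Q = P \<union> Q" using F by auto
  have "Q - P = insert F (Q - insert F P)" using F by auto
  hence "card (Q - P) = Suc (card (Q - insert F P))" using Suc.prems(1)
    by (metis DiffE card_insert_disjoint finite_Diff insertCI)
  hence "n = card (Q - insert F P)" using Suc.hyps by simp
  moreover note Suc.prems(1)
  moreover have "shellable_set (insert F P)" using F Suc.prems by (auto intro: shellable_set.insert)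
  ultimately have "shellable_set (insert F P \<union> Q)"
  proof (rule Suc.hyps(1))
    fix S assume "shellable_set S" "insert F P \<subseteq> S" "S \<subset> insert F P \<union> Q"
    thus "\<exists>F\<in>insert F P \<union> Q - S. attaches S F" using Suc.prems(3)[of S] unfolding eq by blast
  qed
  thus ?case by (simp only: eq)
qed

section \<open>Shellable sets of triangles are acyclic in low degrees\<close>

lemma attaches_edge:
  assumes "attaches P F" "card F = 3" "G \<in> P"
  shows "\<exists>G'\<in>P. G \<inter> F \<subseteq> G' \<and> card (G' \<inter> F) = 2"
proof -
  obtain G' where "G' \<in> P" "G \<inter> F \<subseteq> G'" "Suc (card (G' \<inter> F)) = card F"
    using assms unfolding attaches_def by blast
  thus ?thesis using assms(2) by auto
qed

text \<open>Degree 0 of acyclicity: a function that is constant on each triangle is constant,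
  because every new triangle shares a vertex with an earlier one.\<close>

lemma shellable_set_connected:
  assumes "shellable_set T" "\<forall>F\<in>T. card F = 3"
    and "\<forall>F\<in>T. \<forall>p\<in>F. \<forall>q\<in>F. f p = f q"
  shows "\<exists>c. \<forall>F\<in>T. \<forall>p\<in>F. f p = c"
  using assms
proof (induction rule: shellable_set.induct)
  case empty
  show ?case by simp
next
  case (insert P F)
  have "\<forall>F\<in>P. \<forall>p\<in>F. \<forall>q\<in>F. f p = f q"
    by (rule ballI, rule bspec[OF insert.prems(2)], rule insertI2)
  then obtain c where c: "\<forall>F\<in>P. \<forall>p\<in>F. f p = c" using insert.IH insert.prems(1) by blast
  show ?case
  proof (cases "P = {}")
    case True
    have "\<exists>c. \<forall>p\<in>F. f p = c" using insert.prems(2) by blast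
    thus ?thesis using True by simp
  next
    case False
    then obtain G where "G \<in> P" by auto
    then obtain G' where G': "G' \<in> P" "card (G' \<inter> F) = 2"
      using attaches_edge[OF \<open>attaches P F\<close>, of G] insert.prems(1) by auto
    then obtain p where "p \<in> G' \<inter> F" by (metis card.empty ex_in_conv zero_neq_numeral)
    hence "p \<in> F" "f p = c" using c G' by auto
    moreover have "\<forall>q\<in>F. f q = f p" using insert.prems(2) \<open>p \<in> F\<close> by blast
    ultimately have "\<forall>q\<in>F. f q = c" by metis
    thus ?thesis using c by auto
  qed
qed

text \<open>The same argument inside the link of \<open>z\<close>, where a triangle \<open>F\<close>
  through \<open>z\<close> becomes the edge \<open>F - {z}\<close>.\<close>

lemma shellable_set_link_connected:
  assumes "shellable_set T" "\<forall>F\<in>T. card F = 3"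
    and "\<forall>F\<in>T. z \<in> F \<longrightarrow> (\<forall>p\<in>F - {z}. \<forall>q\<in>F - {z}. f p = f q)"
  shows "\<exists>c. \<forall>F\<in>T. z \<in> F \<longrightarrow> (\<forall>p\<in>F - {z}. f p = c)"
  using assms
proof (induction rule: shellable_set.induct)
  case empty
  show ?case by simp
next
  case (insert P F)
  have "\<forall>F\<in>P. card F = 3" using insert.prems(1) by simp
  moreover have "\<forall>F\<in>P. z \<in> F \<longrightarrow> (\<forall>p\<in>F - {z}. \<forall>q\<in>F - {z}. f p = f q)"
    by (rule ballI, rule bspec[OF insert.prems(2)], rule insertI2)
  ultimately have "\<exists>c. \<forall>F\<in>P. z \<in> F \<longrightarrow> (\<forall>p\<in>F - {z}. f p = c)"
    by (rule insert.IH)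
  then obtain c where c: "\<forall>F\<in>P. z \<in> F \<longrightarrow> (\<forall>p\<in>F - {z}. f p = c)" ..
  show ?case
  proof (cases "z \<in> F \<and> (\<exists>G\<in>P. z \<in> G)")
    case False
    show ?thesis
    proof (cases "z \<in> F")
      case True
      have "\<exists>c. \<forall>p\<in>F - {z}. f p = c"
        using bspec[OF insert.prems(2) insertI1, THEN mp, OF True] by blast
      thus ?thesis using False True by auto
    qed (use c in auto)
  next
    case True
    then obtain G where "G \<in> P" "z \<in> G" by auto
    \<comment> \<open>\<open>G'\<close> contains \<open>G \<inter> F\<close> and hence
      \<open>z\<close>; the second vertex it shares with \<open>F\<close> is common to both link
      edges.\<close>
    then obtain G' where G': "G' \<in> P" "z \<in> G'" "card (G' \<inter> F) = 2"
      using attaches_edge[OF \<open>attaches P F\<close>, of G] insert.prems(1) True by auto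
    then obtain a b where "G' \<inter> F = {a, b}" "a \<noteq> b" by (meson card_2_iff)
    then obtain p where p: "p \<in> G'" "p \<in> F" "p \<noteq> z" by blast
    have "\<forall>q\<in>F - {z}. f q = c"
    proof
      fix q assume "q \<in> F - {z}"
      hence "f q = f p"
        using p True bspec[OF insert.prems(2) insertI1, THEN mp] by blast
      thus "f q = c" using c G' p by simp
    qed
    thus ?thesis using c by auto
  qed
qed

text \<open>Degree 1 of acyclicity, with \<open>\<noteq>\<close> on booleans as addition modulo 2:
  the cocycle \<open>c\<close> is the coboundary of \<open>f\<close>. The potential \<open>f\<close>
  is extended along the shelling; once \<open>c\<close> agrees with it on two edges of a triangle,
  the cocycle condition settles the third.\<close>

lemma shellable_set_cocycle:
  assumes "shellable_set T" "\<forall>F\<in>T. card F = 3"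
    and "\<And>a b d. {a, b, d} \<in> T \<Longrightarrow> a \<noteq> b \<Longrightarrow> b \<noteq> d \<Longrightarrow> a \<noteq> d \<Longrightarrow> c {a, b} = (c {b, d} \<noteq> c {a, d})"
  shows "\<exists>f :: 'a \<Rightarrow> bool. \<forall>F\<in>T. \<forall>a\<in>F. \<forall>b\<in>F. a \<noteq> b \<longrightarrow> c {a, b} = (f a \<noteq> f b)"
  using assms
proof (induction rule: shellable_set.induct)
  case empty
  show ?case by simp
next
  case (insert P F)
  have "\<exists>f :: 'a \<Rightarrow> bool. \<forall>F\<in>P. \<forall>a\<in>F. \<forall>b\<in>F. a \<noteq> b \<longrightarrow> c {a, b} = (f a \<noteq> f b)"
  proof (rule insert.IH)
    show "\<forall>F\<in>P. card F = 3" using insert.prems(1) by simp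
    show "c {a, b} = (c {b, d} \<noteq> c {a, d})" if "{a, b, d} \<in> P" "a \<noteq> b" "b \<noteq> d" "a \<noteq> d" for a b d
      using that by (intro insert.prems(2)) simp_all
  qed
  then obtain f :: "'a \<Rightarrow> bool"
    where f0: "\<forall>F\<in>P. \<forall>a\<in>F. \<forall>b\<in>F. a \<noteq> b \<longrightarrow> c {a, b} = (f a \<noteq> f b)" ..
  note f = f0[rule_format]
  have card: "card F = 3" using insert.prems by simp
  have coc: "c {a, b} = (c {b, d} \<noteq> c {a, d})" if "F = {a, b, d}" "a \<noteq> b" "b \<noteq> d" "a \<noteq> d" for a b d
    using insert.prems(2)[of a b d] that by auto
  show ?case
  proof (cases "P = {}")
    case True
    obtain a b d where F: "F = {a, b, d}" "a \<noteq> b" "b \<noteq> d" "a \<noteq> d" using card by (metis card_3_iff)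
    \<comment> \<open>Potential on the first triangle: \<open>d\<close> gets the value 0, each other
      vertex the value of \<open>c\<close> on its edge to \<open>d\<close>.\<close>
    show ?thesis using True F coc[OF F]
      by (intro exI[of _ "\<lambda>p. if p = d then False else c {p, d}"]) (auto simp: insert_commute)
  next
    case False
    then obtain G' where G': "G' \<in> P" "card (G' \<inter> F) = 2"
      using attaches_edge[OF \<open>attaches P F\<close> card] by blast
    then obtain a b where ab: "G' \<inter> F = {a, b}" "a \<noteq> b" by (meson card_2_iff)
    have "finite F" using card by (metis card.infinite zero_neq_numeral)
    hence "card (F - {a, b}) = 1" using ab card by (subst card_Diff_subset) auto
    then obtain d where "F - {a, b} = {d}" by (meson card_1_singletonE)
    hence F: "F = {a, b, d}" "b \<noteq> d" "a \<noteq> d" using ab by auto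
    have cab: "c {a, b} = (f a \<noteq> f b)" using f[OF G'(1), of a b] ab by blast
    show ?thesis
    proof (cases "\<exists>G\<in>P. d \<in> G")
      case True
      then obtain G where "G \<in> P" "d \<in> G" by blast
      moreover have "d \<in> F" using F by simp
      ultimately obtain G2 where G2: "G2 \<in> P" "d \<in> G2" "card (G2 \<inter> F) = 2"
        using attaches_edge[OF \<open>attaches P F\<close> card, of G] by auto
      \<comment> \<open>\<open>d\<close> is an old vertex, so a second edge of \<open>F\<close>,
        through \<open>d\<close>, lies in an earlier triangle and \<open>f\<close> needs no
        change.\<close>
      have "a \<in> G2 \<or> b \<in> G2"
      proof (rule ccontr)
        assume "\<not> ?thesis"
        hence "G2 \<inter> F = {d}" using F G2 by auto
        thus False using G2 by simp
      qed
      hence "c {a, d} = (f a \<noteq> f d) \<and> c {b, d} = (f b \<noteq> f d)"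
        using coc[OF F(1) ab(2) F(2,3)] cab f[OF G2(1), of a d] f[OF G2(1), of b d] G2(2) F by auto
      thus ?thesis using cab F f by (intro exI[of _ f]) (auto simp: insert_commute)
    next
      case new: False
      \<comment> \<open>The value at the new vertex \<open>d\<close> is forced by the edge
        \<open>{a, d}\<close>; earlier triangles avoid \<open>d\<close> and keep their
        values.\<close>
      define g where "g = f(d := (c {a, d} \<noteq> f a))"
      have "c {p, q} = (g p \<noteq> g q)" if "G \<in> P" "p \<in> G" "q \<in> G" "p \<noteq> q" for G p q
        using f[OF that] that new by (auto simp: g_def)
      moreover have "c {a, b} = (g a \<noteq> g b)" "c {a, d} = (g a \<noteq> g d)" "c {b, d} = (g b \<noteq> g d)"
        using coc[OF F(1) ab(2) F(2,3)] cab F by (auto simp: g_def)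
      ultimately show ?thesis using F by (intro exI[of _ g]) (auto simp: insert_commute)
    qed
  qed
qed

section \<open>Local shellability of sets of triangles implies shellability\<close>

lemma card_3_eq:
  assumes "card F = 3" "p \<in> F" "q \<in> F" "r \<in> F" "p \<noteq> q" "q \<noteq> r" "p \<noteq> r"
  shows "F = {p, q, r}"
proof -
  have "finite F" using assms(1) by (metis card.infinite zero_neq_numeral)
  moreover have "card {p, q, r} = 3" using assms by simp
  ultimately show ?thesis using assms by (metis card_subset_eq empty_subsetI insert_subset)
qed

text \<open>Distinct triangles share at most two vertices, so two common vertices already give a
  shared face of codimension one.\<close>

lemma attaches_triangleI:
  assumes F: "card F = 3" "F \<notin> S" and S: "\<forall>G\<in>S. card G = 3"
    and ex: "\<And>G. G \<in> S \<Longrightarrow> \<exists>G'\<in>S. \<exists>p q. p \<noteq> q \<and> p \<in> G' \<inter> F \<and> q \<in> G' \<inter> F \<and> G \<inter> F \<subseteq> G'"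
  shows "attaches S F"
  unfolding attaches_def
proof
  fix G assume "G \<in> S"
  then obtain G' p q where G': "G' \<in> S" "p \<noteq> q" "p \<in> G' \<inter> F" "q \<in> G' \<inter> F" "G \<inter> F \<subseteq> G'"
    using ex by blast
  have "finite F" using F by (metis card.infinite zero_neq_numeral)
  have "G' \<inter> F \<subset> F"
  proof -
    have "\<not> F \<subseteq> G'"
      using F S G' by (metis card.infinite card_subset_eq zero_neq_numeral)
    thus ?thesis by blast
  qed
  hence "card (G' \<inter> F) < 3" using psubset_card_mono[OF \<open>finite F\<close>] F by metis
  moreover have "card {p, q} \<le> card (G' \<inter> F)" using G' \<open>finite F\<close> by (intro card_mono) auto
  ultimately have "Suc (card (G' \<inter> F)) = card F" using G' F by simp
  thus "\<exists>G'\<in>S. G \<inter> F \<subseteq> G' \<and> Suc (card (G' \<inter> F)) = card F" using G' by blast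
qed

text \<open>The graph N of the overview: link edges along which the cone with apex \<open>v\<close>
  can be glued to triangles avoiding \<open>v\<close>.\<close>

definition inner_link :: "'a set set \<Rightarrow> 'a \<Rightarrow> 'a set set" where
  "inner_link T v = {e. v \<notin> e \<and> insert v e \<in> T \<and> (\<exists>G\<in>T. v \<notin> G \<and> e \<subseteq> G)}"

section \<open>Families of triangles that are shellable on every set of at most 7 vertices\<close>

context
  fixes T :: "'a set set"
  assumes card3: "\<forall>F\<in>T. card F = 3"
    and small: "\<And>U. finite U \<Longrightarrow> card U \<le> 7 \<Longrightarrow> shellable_set {F \<in> T. F \<subseteq> U}"
begin

lemma triangle_cases:
  assumes "F \<in> T" "v \<in> F"
  obtains x y where "F = {v, x, y}" "x \<noteq> v" "y \<noteq> v" "x \<noteq> y"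
proof -
  obtain a b c where "F = {a, b, c}" "a \<noteq> b" "b \<noteq> c" "a \<noteq> c" using assms card3 by (metis card_3_iff)
  thus thesis using that[of b c] that[of a c] that[of a b] assms(2) by (auto simp: insert_commute)
qed

lemma triangle_distinct:
  assumes "{a, b, c} \<in> T"
  shows "a \<noteq> b" "b \<noteq> c" "a \<noteq> c"
proof -
  have "card {a, b, c} = 3" using assms card3 by blast
  thus "a \<noteq> b" "b \<noteq> c" "a \<noteq> c" by (auto simp: card_insert_if split: if_splits)
qed

lemma triangle_eq:
  assumes "F \<in> T" "p \<in> F" "q \<in> F" "r \<in> F" "p \<noteq> q" "q \<noteq> r" "p \<noteq> r"
  shows "F = {p, q, r}"
  using card_3_eq assms card3 by metis

lemma finite_triangle: "F \<in> T \<Longrightarrow> finite F"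
  using card3 by (metis card.infinite zero_neq_numeral)

text \<open>Otherwise membership in \<open>{a, b}\<close> would be constant on each edge of the link
  of \<open>z\<close> within these five vertices, yet differ between \<open>a\<close> and
  \<open>c\<close>.\<close>

lemma link_cross_edge:
  assumes "{z, a, b} \<in> T" "{z, c, d} \<in> T" "{a, b} \<inter> {c, d} = {}"
  shows "\<exists>x\<in>{a, b}. \<exists>y\<in>{c, d}. {z, x, y} \<in> T"
proof (rule ccontr)
  assume no: "\<not> ?thesis"
  let ?U = "{z, a, b, c, d}" and ?f = "\<lambda>p. p \<in> {a, b}"
  let ?T = "{F \<in> T. F \<subseteq> ?U}"
  note dis = triangle_distinct[OF assms(1)] triangle_distinct[OF assms(2)]
  have "card ?U \<le> 7" by (simp add: card_insert_if)
  hence sh: "shellable_set ?T" by (intro small) simp_all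
  have "\<exists>k. \<forall>F\<in>?T. z \<in> F \<longrightarrow> (\<forall>p\<in>F - {z}. ?f p = k)"
  proof (rule shellable_set_link_connected[OF sh])
    show "\<forall>F\<in>?T. card F = 3" using card3 by blast
    show "\<forall>F\<in>?T. z \<in> F \<longrightarrow> (\<forall>p\<in>F - {z}. \<forall>q\<in>F - {z}. ?f p = ?f q)"
    proof (intro ballI impI)
      fix F p q assume F: "F \<in> ?T" "z \<in> F" "p \<in> F - {z}" "q \<in> F - {z}"
      show "?f p = ?f q"
      proof (rule ccontr)
        assume ne: "?f p \<noteq> ?f q"
        hence "F = {z, p, q}" using F by (intro triangle_eq) auto
        hence "{z, p, q} \<in> T" "{z, q, p} \<in> T" using F by (auto simp: insert_commute)
        moreover have "p \<in> ?U - {z}" "q \<in> ?U - {z}" using F by blast+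
        ultimately show False using no ne by auto
      qed
    qed
  qed
  then obtain k where k0: "\<forall>F\<in>?T. z \<in> F \<longrightarrow> (\<forall>p\<in>F - {z}. ?f p = k)" ..
  note k = k0[rule_format]
  have "?f a = k" using assms dis by (intro k[of "{z, a, b}"]) auto
  moreover have "?f c = k" using assms dis by (intro k[of "{z, c, d}"]) auto
  ultimately show False using assms(3) by auto
qed

text \<open>Otherwise membership in \<open>F\<close> would separate the triangles inside the six
  vertices of \<open>F \<union> G\<close>.\<close>

lemma not_disconnected:
  assumes "F \<in> T" "G \<in> T" "F \<inter> G = {}"
  shows "\<exists>H\<in>T. H \<inter> F \<noteq> {} \<and> H \<inter> G \<noteq> {}"
proof (rule ccontr)
  assume no: "\<not> ?thesis"
  let ?U = "F \<union> G"
  let ?T = "{H \<in> T. H \<subseteq> ?U}"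
  have "card F = 3" "card G = 3" using assms card3 by auto
  hence "card ?U \<le> 7" using card_Un_le[of F G] by simp
  hence sh: "shellable_set ?T" using assms finite_triangle by (intro small) simp_all
  have "\<exists>k. \<forall>H\<in>?T. \<forall>p\<in>H. (p \<in> F) = k"
    by (rule shellable_set_connected[OF sh]) (use card3 no in blast)+
  then obtain k where k0: "\<forall>H\<in>?T. \<forall>p\<in>H. (p \<in> F) = k" ..
  note k = k0[rule_format]
  obtain p q where "p \<in> F" "q \<in> G"
    using \<open>card F = 3\<close> \<open>card G = 3\<close> by (metis card.empty ex_in_conv zero_neq_numeral)
  thus False using k[of F p] k[of G q] assms by auto
qed

lemma inner_link_edge:
  assumes "e \<in> inner_link T v"
  obtains x y where "e = {x, y}" "{v, x, y} \<in> T" "x \<noteq> y"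
proof -
  have e: "insert v e \<in> T" "v \<notin> e" using assms by (auto simp: inner_link_def)
  obtain x y where xy: "insert v e = {v, x, y}" "x \<noteq> v" "y \<noteq> v" "x \<noteq> y"
    using triangle_cases[OF e(1), of v] by blast
  have "e = {x, y}" using xy e(2) insert_ident[of v e "{x, y}"] by simp
  thus thesis using that e(1) xy by blast
qed

text \<open>Connectedness of N, phrased for a set \<open>M\<close> of edges and its complement. If
  no edge of \<open>M\<close> met the complement, \<open>M\<close> would define a 1-cocycle that is
  not a coboundary on at most 7 vertices.\<close>

lemma inner_link_connected:
  assumes "M \<subseteq> inner_link T v" "M \<noteq> {}" "inner_link T v - M \<noteq> {}"
  shows "\<exists>e\<in>M. \<exists>e'\<in>inner_link T v - M. e \<inter> e' \<noteq> {}"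
proof (rule ccontr)
  let ?N = "inner_link T v"
  assume "\<not> ?thesis"
  hence no: "e \<inter> e' = {}" if "e \<in> M" "e' \<in> ?N" "e' \<notin> M" for e e' using that by blast
  obtain e1 e2 where e: "e1 \<in> M" "e1 \<in> ?N" "e2 \<in> ?N" "e2 \<notin> M" using assms by blast
  \<comment> \<open>The edge from \<open>x\<close> to \<open>y\<close> is the middle of the path a,
    x, y, b of the overview.\<close>
  have "\<exists>x\<in>e1. \<exists>y\<in>e2. {v, x, y} \<in> T"
  proof -
    obtain a b where ab: "e1 = {a, b}" "{v, a, b} \<in> T" using inner_link_edge[OF e(2)] .
    obtain c d where cd: "e2 = {c, d}" "{v, c, d} \<in> T" using inner_link_edge[OF e(3)] .
    have "e1 \<inter> e2 = {}" using no e by blast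
    thus ?thesis using link_cross_edge[OF ab(2) cd(2)] ab(1) cd(1) by blast
  qed
  then obtain x y where xy: "x \<in> e1" "y \<in> e2" "{v, x, y} \<in> T" by blast
  note dxy = triangle_distinct[OF xy(3)]
  obtain G1 where G1: "G1 \<in> T" "v \<notin> G1" "e1 \<subseteq> G1" using e by (auto simp: inner_link_def)
  obtain G2 where G2: "G2 \<in> T" "v \<notin> G2" "e2 \<subseteq> G2" using e by (auto simp: inner_link_def)
  define C where "C = \<Union>M"
  \<comment> \<open>At \<open>v\<close> the cocycle is the indicator of \<open>C\<close>. A link
    edge outside N gets 1 if exactly one end lies in \<open>C\<close>, as triangles through
    \<open>v\<close> demand; all other edges get 0.\<close>
  define c where "c = (\<lambda>e. (\<exists>w\<in>C. e = {v, w}) \<or>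
    (v \<notin> e \<and> e \<notin> ?N \<and> insert v e \<in> T \<and> e \<inter> C \<noteq> {} \<and> \<not> e \<subseteq> C))"
  have vC: "v \<notin> C" using assms(1) unfolding C_def inner_link_def by blast
  have cv: "c {v, w} \<longleftrightarrow> w \<in> C" "c {w, v} \<longleftrightarrow> w \<in> C" if "w \<noteq> v" for w
    using that vC unfolding c_def by (auto simp: doubleton_eq_iff)
  \<comment> \<open>An edge of a triangle avoiding \<open>v\<close> that also spans a triangle with
    \<open>v\<close> belongs to N, where \<open>c\<close> is 0.\<close>
  have c0: "\<not> c e" if "F \<in> T" "v \<notin> F" "e \<subseteq> F" for F e
    using that unfolding c_def inner_link_def by blast
  have c1: "c {w, u} \<longleftrightarrow> ((w \<in> C) \<noteq> (u \<in> C))" if F: "{v, w, u} \<in> T" for w u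
  proof -
    note d = triangle_distinct[OF F]
    show ?thesis
    proof (cases "{w, u} \<in> ?N")
      case True
      hence "\<not> c {w, u}" using d unfolding c_def by auto
      \<comment> \<open>An edge of \<open>M\<close> has both ends in \<open>C\<close>; an edge of N
        outside \<open>M\<close> is disjoint from every edge of \<open>M\<close> and has
        neither.\<close>
      moreover have "w \<in> C \<longleftrightarrow> u \<in> C"
        using no[of _ "{w, u}"] True unfolding C_def by (cases "{w, u} \<in> M") auto
      ultimately show ?thesis by blast
    next
      case False
      thus ?thesis using d F unfolding c_def by auto
    qed
  qed
  \<comment> \<open>The source of the bound 7: the vertex \<open>v\<close> and two
    triangles.\<close>
  let ?U = "insert v (G1 \<union> G2)"
  let ?T = "{F \<in> T. F \<subseteq> ?U}" and ?T' = "{F \<in> T. F \<subseteq> G1 \<union> G2}"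
  have fin: "finite (G1 \<union> G2)" using G1 G2 finite_triangle by blast
  have "card G1 = 3" "card G2 = 3" using G1 G2 card3 by auto
  hence "card (G1 \<union> G2) \<le> 6" using card_Un_le[of G1 G2] by simp
  hence "card ?U \<le> 7" using fin by (simp add: card_insert_if)
  hence sh: "shellable_set ?T" using fin by (intro small) simp_all
  have sh': "shellable_set ?T'" using small[OF fin] \<open>card (G1 \<union> G2) \<le> 6\<close> by simp
  have "\<exists>f :: 'a \<Rightarrow> bool. \<forall>F\<in>?T. \<forall>a\<in>F. \<forall>b\<in>F. a \<noteq> b \<longrightarrow> c {a, b} = (f a \<noteq> f b)"
  proof (rule shellable_set_cocycle[OF sh])
    show "\<forall>F\<in>?T. card F = 3" using card3 by blast
    fix a b d assume "{a, b, d} \<in> ?T" and dis: "a \<noteq> b" "b \<noteq> d" "a \<noteq> d"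
    hence F: "{a, b, d} \<in> T" by blast
    consider "v = a" | "v = b" | "v = d" | "v \<notin> {a, b, d}" by blast
    thus "c {a, b} = (c {b, d} \<noteq> c {a, d})"
    proof cases
      case 1
      thus ?thesis using cv[of b] cv[of d] c1[of b d] dis F by auto
    next
      case 2
      thus ?thesis using cv[of a] cv[of d] c1[of a d] dis F by (auto simp: insert_commute)
    next
      case 3
      thus ?thesis using cv[of a] cv[of b] c1[of a b] dis F by (auto simp: insert_commute)
    next
      case 4
      thus ?thesis using c0[OF F] by simp
    qed
  qed
  then obtain f :: "'a \<Rightarrow> bool"
    where f0: "\<forall>F\<in>?T. \<forall>a\<in>F. \<forall>b\<in>F. a \<noteq> b \<longrightarrow> c {a, b} = (f a \<noteq> f b)" ..
  note f = f0[rule_format]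
  \<comment> \<open>Since \<open>c\<close> vanishes away from \<open>v\<close>, the potential is
    constant on \<open>G1 \<union> G2\<close>. So \<open>c\<close> would agree on
    \<open>{v, x}\<close> and \<open>{v, y}\<close>, although \<open>x\<close> lies in
    \<open>C\<close> and \<open>y\<close> does not.\<close>
  have f_const: "f p = f q" if "F \<in> ?T'" "p \<in> F" "q \<in> F" for F p q
  proof -
    have "\<not> c {p, q}" using that G1 G2 by (intro c0[of F]) auto
    moreover have "F \<in> ?T" using that by blast
    ultimately show ?thesis using f[of F p q] that by (cases "p = q") auto
  qed
  have "\<exists>k. \<forall>F\<in>?T'. \<forall>p\<in>F. f p = k"
  proof (rule shellable_set_connected[OF sh'])
    show "\<forall>F\<in>?T'. card F = 3" using card3 by blast
    show "\<forall>F\<in>?T'. \<forall>p\<in>F. \<forall>q\<in>F. f p = f q" using f_const by (intro ballI)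
  qed
  then obtain k where k: "\<forall>F\<in>?T'. \<forall>p\<in>F. f p = k" ..
  have "f x = k" "f y = k" using k G1 G2 xy by blast+
  moreover have "x \<in> C" "y \<notin> C" using xy e no unfolding C_def by blast+
  moreover have F: "{v, x, y} \<in> ?T" using xy G1 G2 by blast
  ultimately show False
    using f[OF F, of v x] f[OF F, of v y] cv[of x] cv[of y] dxy by auto
qed

text \<open>Three stages: the triangles avoiding \<open>v\<close>, then the cones over N, then the
  remaining triangles through \<open>v\<close>. Connectivity keeps each of the last two stages from
  getting stuck.\<close>

lemma shellable_set_deletion:
  assumes fin: "finite T" and v: "v \<in> \<Union>T" and del: "shellable_set {F \<in> T. v \<notin> F}"
  shows "shellable_set T"
proof -
  let ?T' = "{F \<in> T. v \<notin> F}" and ?N = "inner_link T v"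
  let ?Q = "insert v ` ?N"
  have QT: "?Q \<subseteq> T" by (auto simp: inner_link_def)
  have "shellable_set (?T' \<union> ?Q)"
  proof (rule shellable_set_extend[OF _ del])
    show "finite ?Q" using QT fin finite_subset by blast
    fix S assume S: "?T' \<subseteq> S" "S \<subset> ?T' \<union> ?Q"
    define M where "M = {e \<in> ?N. insert v e \<in> S}"
    have ne: "?N - M \<noteq> {}" using S unfolding M_def by blast
    \<comment> \<open>The next cone is taken over an edge touching one that is already coned, unless
      none is.\<close>
    have "\<exists>e'\<in>?N - M. M = {} \<or> (\<exists>e\<in>M. e \<inter> e' \<noteq> {})"
      using inner_link_connected[of M v] ne unfolding M_def by blast
    then obtain e' where e': "e' \<in> ?N" "insert v e' \<notin> S" "M = {} \<or> (\<exists>e\<in>M. e \<inter> e' \<noteq> {})"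
      unfolding M_def by blast
    let ?F = "insert v e'"
    have F: "?F \<in> T" "v \<notin> e'" using e' by (auto simp: inner_link_def)
    obtain H where H: "H \<in> ?T'" "e' \<subseteq> H" using e' by (auto simp: inner_link_def)
    obtain x y where xy: "e' = {x, y}" "x \<noteq> y" "M \<noteq> {} \<Longrightarrow> \<exists>e\<in>M. x \<in> e"
    proof -
      obtain a b where ab: "e' = {a, b}" "a \<noteq> b" using inner_link_edge[OF e'(1)] .
      have ba: "e' = {b, a}" using ab by blast
      show thesis
      proof (cases "M = {}")
        case True
        thus thesis using that[OF ab] by blast
      next
        case False
        then obtain e p where "e \<in> M" "p \<in> e" "p \<in> e'" using e' by blast
        moreover from this have "p = a \<or> p = b" using ab by blast
        ultimately show thesis using that[OF ab] that[OF ba] ab(2) by blast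
      qed
    qed
    have "attaches S ?F"
    proof (rule attaches_triangleI)
      show "card ?F = 3" using F card3 by blast
      show "?F \<notin> S" by fact
      show "\<forall>G\<in>S. card G = 3" using S QT card3 by blast
      fix G assume G: "G \<in> S"
      show "\<exists>G'\<in>S. \<exists>p q. p \<noteq> q \<and> p \<in> G' \<inter> ?F \<and> q \<in> G' \<inter> ?F \<and> G \<inter> ?F \<subseteq> G'"
      proof (cases "v \<in> G")
        case False
        hence "G \<inter> ?F \<subseteq> H" using H by blast
        thus ?thesis using H S xy by (intro bexI[of _ H] exI[of _ x] exI[of _ y]) auto
      next
        case True
        show ?thesis
        proof (cases "G \<inter> e' = {}")
          case False
          then obtain p where "p \<in> G" "p \<in> e'" by blast
          thus ?thesis using True G F(2) by (intro bexI[of _ G] exI[of _ v] exI[of _ p]) auto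
        next
          \<comment> \<open>Here \<open>G\<close> meets the new triangle only in \<open>v\<close>,
            which the earlier cone over an edge through \<open>x\<close> covers by the side from
            \<open>v\<close> to \<open>x\<close>.\<close>
          case dis: True
          have "G \<in> ?Q" using True G S by blast
          hence "M \<noteq> {}" using G unfolding M_def by blast
          then obtain e where e: "e \<in> M" "x \<in> e" using xy by blast
          thus ?thesis using dis xy F(2) unfolding M_def
            by (intro bexI[of _ "insert v e"] exI[of _ v] exI[of _ x]) auto
        qed
      qed
    qed
    thus "\<exists>F\<in>?T' \<union> ?Q - S. attaches S F" using e' by blast
  qed
  hence "shellable_set ((?T' \<union> ?Q) \<union> T)"
  proof (rule shellable_set_extend[OF fin])
    fix S assume S: "?T' \<union> ?Q \<subseteq> S" "S \<subset> ?T' \<union> ?Q \<union> T"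
    hence ST: "S \<subset> T" using QT by blast
    \<comment> \<open>All cones over N are already in \<open>S\<close>, so a missing triangle has
      its side opposite \<open>v\<close> in no triangle avoiding \<open>v\<close>.\<close>
    have free: "F \<in> S" if "F = {v, p, q}" "F \<in> T" "G \<in> ?T'" "p \<in> G" "q \<in> G" for F G p q
    proof -
      have "{v, p, q} \<in> T" using that by simp
      note d = triangle_distinct[OF this]
      hence "{p, q} \<in> ?N" using that unfolding inner_link_def by blast
      thus ?thesis using S that by blast
    qed
    \<comment> \<open>If a triangle \<open>G\<close> avoiding \<open>v\<close> contained
      \<open>y\<close>, a cross edge in the link of \<open>y\<close> would give either a triangle of
      \<open>S\<close> through \<open>v\<close> and \<open>y\<close>, or a triangle avoiding
      \<open>v\<close> on \<open>{x, y}\<close>, which puts \<open>{v, x, y}\<close> into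
      \<open>S\<close>.\<close>
    have new: "y \<notin> \<Union>?T'" if F: "{v, x, y} \<in> T" "{v, x, y} \<notin> S"
      and noS: "\<And>H. H \<in> S \<Longrightarrow> v \<in> H \<Longrightarrow> y \<notin> H" for x y
    proof
      assume "y \<in> \<Union>?T'"
      then obtain G where G: "G \<in> T" "v \<notin> G" "y \<in> G" by blast
      then obtain c d where cd: "G = {y, c, d}" using triangle_cases by metis
      have xG: "x \<notin> G" using free[of "{v, x, y}" x y G] F G by blast
      have "\<exists>p\<in>{v, x}. \<exists>q\<in>{c, d}. {y, p, q} \<in> T"
      proof (rule link_cross_edge)
        show "{y, v, x} \<in> T" using F by (simp add: insert_commute)
        show "{y, c, d} \<in> T" using G cd by simp
        show "{v, x} \<inter> {c, d} = {}" using G cd xG by blast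
      qed
      then obtain p q where pq: "p = v \<or> p = x" "q \<in> {c, d}" "{y, p, q} \<in> T" by blast
      show False
      proof (cases "p = v")
        case True
        have "{y, v, q} \<in> S"
          using free[of "{y, v, q}" y q G] pq True G cd by (auto simp: insert_commute)
        thus False using noS[of "{y, v, q}"] by blast
      next
        case False
        have "v \<notin> {y, p, q}" using pq False G cd triangle_distinct[OF F(1)] by auto
        hence "{y, p, q} \<in> ?T'" using pq by simp
        thus False using free[of "{v, x, y}" x y "{y, p, q}"] F False pq by auto
      qed
    qed
    \<comment> \<open>Otherwise, by \<open>new\<close>, triangles through \<open>v\<close> and
      triangles avoiding \<open>v\<close> have no common vertex, against
      \<open>not_disconnected\<close>.\<close>
    have noS: "\<exists>H\<in>S. v \<in> H" if S_ne: "S \<noteq> {}"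
    proof (rule ccontr)
      assume no: "\<not> ?thesis"
      obtain G where G: "G \<in> S" "v \<notin> G" using S_ne no by blast
      hence "G \<in> ?T'" using ST by blast
      have avoid: "y \<notin> \<Union>?T'" if F: "F \<in> T" "v \<in> F" "y \<in> F" for F y
      proof (cases "y = v")
        case False
        obtain a b where "F = {v, a, b}" using triangle_cases[OF F(1,2)] .
        hence "F = {v, a, y} \<or> F = {v, b, y}" using False F(3) by blast
        then obtain x where "F = {v, x, y}" by blast
        thus ?thesis using new[of x y] F no by blast
      qed blast
      obtain F where F: "F \<in> T" "v \<in> F" using v by blast
      have "F \<inter> G = {}" using avoid[OF F] \<open>G \<in> ?T'\<close> by blast
      moreover have "G \<in> T" using \<open>G \<in> ?T'\<close> by blast
      ultimately obtain H x y where H: "H \<in> T" "x \<in> H" "x \<in> F" "y \<in> H" "y \<in> G"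
        using not_disconnected[OF F(1)] by blast
      show False
      proof (cases "v \<in> H")
        case True
        thus False using avoid[OF H(1) True H(4)] H(5) \<open>G \<in> ?T'\<close> by blast
      next
        case False
        thus False using avoid[OF F H(3)] H(1,2) by blast
      qed
    qed
    show "\<exists>F\<in>?T' \<union> ?Q \<union> T - S. attaches S F"
    proof (cases "S = {}")
      case True
      thus ?thesis using ST by (auto simp: attaches_def)
    next
      case False
      then obtain G where G: "G \<in> S" "v \<in> G" using noS by blast
      then obtain a b where ab: "G = {v, a, b}" "a \<noteq> v" "b \<noteq> v" "a \<noteq> b"
        using ST triangle_cases by (metis psubset_imp_subset subsetD)
      obtain F where F: "F \<in> T" "F \<notin> S" using ST by blast
      hence "v \<in> F" using S by blast
      then obtain c d where cd: "F = {v, c, d}" "c \<noteq> v" "d \<noteq> v" "c \<noteq> d"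
        using triangle_cases[OF F(1)] by blast
      hence "F = {v, d, c}" by blast
      hence F_with: "\<exists>y. F = {v, x, y}" if "x \<in> {c, d}" for x using that cd(1) by blast
      \<comment> \<open>A missing triangle with a side at \<open>v\<close> already covered. If
        \<open>F\<close> and \<open>G\<close> share only \<open>v\<close>, a cross edge gives a
        triangle between them: if missing, it is chosen; if present, it covers a side of
        \<open>F\<close>.\<close>
      have "\<exists>x y G0. {v, x, y} \<in> T \<and> {v, x, y} \<notin> S \<and> G0 \<in> S \<and> v \<in> G0 \<and> x \<in> G0"
      proof (cases "{a, b} \<inter> {c, d} = {}")
        case False
        then obtain x where x: "x \<in> {a, b}" "x \<in> {c, d}" by blast
        then obtain y where "F = {v, x, y}" using F_with by blast
        thus ?thesis using G F ab x by blast
      next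
        case True
        have "\<exists>x\<in>{a, b}. \<exists>y\<in>{c, d}. {v, x, y} \<in> T"
          using G F ab cd ST True by (intro link_cross_edge) auto
        then obtain x y where xy: "x \<in> {a, b}" "y \<in> {c, d}" "{v, x, y} \<in> T" by blast
        show ?thesis
        proof (cases "{v, x, y} \<in> S")
          case True
          obtain z where "F = {v, y, z}" using xy(2) F_with by blast
          thus ?thesis using True F by blast
        next
          case False
          thus ?thesis using xy G ab by blast
        qed
      qed
      then obtain x y G0 where
        xy: "{v, x, y} \<in> T" "{v, x, y} \<notin> S" and G0: "G0 \<in> S" "v \<in> G0" "x \<in> G0" by blast
      note d = triangle_distinct[OF xy(1)]
      have "attaches S {v, x, y}"
      proof (rule attaches_triangleI)
        show "card {v, x, y} = 3" using xy card3 by blast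
        show "{v, x, y} \<notin> S" by fact
        show "\<forall>G\<in>S. card G = 3" using ST card3 by blast
        fix H assume H: "H \<in> S"
        have notxy: "\<not> (x \<in> H \<and> y \<in> H)"
        proof
          assume xyH: "x \<in> H \<and> y \<in> H"
          show False
          proof (cases "v \<in> H")
            case True
            hence "H = {v, x, y}" using H xyH d ST by (intro triangle_eq) auto
            thus False using H xy by simp
          next
            case False
            hence "H \<in> ?T'" using H ST by blast
            thus False using free[of "{v, x, y}" x y H] xy xyH by blast
          qed
        qed
        show "\<exists>G'\<in>S. \<exists>p q. p \<noteq> q \<and> p \<in> G' \<inter> {v, x, y} \<and> q \<in> G' \<inter> {v, x, y} \<and> H \<inter> {v, x, y} \<subseteq> G'"
        proof (cases "y \<in> H")
          case False
          thus ?thesis using G0 d by (intro bexI[of _ G0] exI[of _ v] exI[of _ x]) auto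
        next
          case True
          \<comment> \<open>Either \<open>H\<close> itself contains \<open>v\<close>, or
            \<open>y\<close> lies in a triangle avoiding \<open>v\<close> and \<open>new\<close>
            applies.\<close>
          have "\<exists>G1\<in>S. v \<in> G1 \<and> y \<in> G1"
            using new[OF xy] True H ST by blast
          then obtain G1 where "G1 \<in> S" "v \<in> G1" "y \<in> G1" by blast
          thus ?thesis using notxy True d by (intro bexI[of _ G1] exI[of _ v] exI[of _ y]) auto
        qed
      qed
      thus ?thesis using xy by blast
    qed
  qed
  moreover have "(?T' \<union> ?Q) \<union> T = T" using QT by blast
  ultimately show ?thesis by simp
qed

end

text \<open>Induction by deleting a vertex. The local hypothesis is inherited, since restricting the
  deletion to \<open>U\<close> is restricting \<open>T\<close> to \<open>U - {v}\<close>.\<close>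

lemma shellable_set_if_locally_shellable:
  assumes "finite T" "\<forall>F\<in>T. card F = 3"
    and "\<And>U. finite U \<Longrightarrow> card U \<le> 7 \<Longrightarrow> shellable_set {F \<in> T. F \<subseteq> U}"
  shows "shellable_set T"
  using assms
proof (induction T rule: finite_psubset_induct)
  case (psubset T)
  show ?case
  proof (cases "T = {}")
    case True
    thus ?thesis by (simp add: shellable_set.empty)
  next
    case False
    then obtain F where "F \<in> T" by blast
    then obtain v where v: "v \<in> F" using psubset.prems(1) by (metis card.empty ex_in_conv zero_neq_numeral)
    have "shellable_set {F \<in> T. v \<notin> F}"
    proof (rule psubset.IH)
      show "{F \<in> T. v \<notin> F} \<subset> T" using v \<open>F \<in> T\<close> by blast
      show "\<forall>F\<in>{F \<in> T. v \<notin> F}. card F = 3" using psubset.prems(1) by blast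
      fix U :: "'a set" assume U: "finite U" "card U \<le> 7"
      have "card (U - {v}) \<le> 7" using U card_Diff1_le[of U v] by linarith
      hence "shellable_set {F \<in> T. F \<subseteq> U - {v}}" using U by (intro psubset.prems(2)) auto
      moreover have "{F \<in> {F \<in> T. v \<notin> F}. F \<subseteq> U} = {F \<in> T. F \<subseteq> U - {v}}" by blast
      ultimately show "shellable_set {F \<in> {F \<in> T. v \<notin> F}. F \<subseteq> U}" by simp
    qed
    thus ?thesis
      using shellable_set_deletion[OF psubset.prems psubset.hyps(1)] v \<open>F \<in> T\<close> by blast
  qed
qed

section \<open>Complexes of dimension at most 2\<close>

lemma simplicial_complex_induced:
  assumes "simplicial_complex V K" "U \<subseteq> V"
  shows "simplicial_complex U (induced_subcomplex K U)"
  using assms finite_subset unfolding simplicial_complex_def induced_subcomplex_def by auto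

lemma facet_above:
  assumes "finite K" "F \<in> K"
  obtains G where "G \<in> facets K" "F \<subseteq> G"
proof -
  obtain G where G: "G \<in> K" "F \<subseteq> G" "\<forall>H\<in>K. G \<subseteq> H \<longrightarrow> G = H"
    using finite_has_maximal2[OF assms] by blast
  hence "G \<in> facets K" unfolding facets_def by blast
  thus thesis using that G(2) by blast
qed

lemma shellable_set_triangles:
  assumes "shellable_set P" "P \<subseteq> facets K" "\<forall>F\<in>K. finite F \<and> card F \<le> 3"
  shows "shellable_set {F \<in> P. card F = 3}"
  using assms
proof (induction rule: shellable_set.induct)
  case empty
  show ?case by (simp add: shellable_set.empty)
next
  case (insert P F)
  let ?P = "{F \<in> P. card F = 3}"
  have IH: "shellable_set ?P" using insert by blast
  show ?case
  proof (cases "card F = 3")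
    case False
    hence "{G \<in> insert F P. card G = 3} = ?P" by blast
    thus ?thesis using IH by simp
  next
    case True
    have "attaches ?P F"
      unfolding attaches_def
    proof
      fix G assume "G \<in> ?P"
      then obtain G' where G': "G' \<in> P" "G \<inter> F \<subseteq> G'" "Suc (card (G' \<inter> F)) = card F"
        using \<open>attaches P F\<close> unfolding attaches_def by blast
      have facets: "G' \<in> facets K" "F \<in> facets K" using G' insert.prems by blast+
      have "G' \<noteq> F" using G' insert.hyps by blast
      hence "\<not> G' \<subseteq> F" using facets facets_not_subset by blast
      hence "G' \<inter> F \<subset> G'" by blast
      moreover have "card G' \<le> 3" using facets insert.prems by (simp add: facets_def)
      moreover have "finite G'" using facets insert.prems by (simp add: facets_def)
      ultimately have "card G' = 3"
        using psubset_card_mono[of G' "G' \<inter> F"] G' True by simp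
      thus "\<exists>G'\<in>?P. G \<inter> F \<subseteq> G' \<and> Suc (card (G' \<inter> F)) = card F" using G' by blast
    qed
    hence "shellable_set (insert F ?P)" using IH insert.hyps by (intro shellable_set.insert) auto
    moreover have "{G \<in> insert F P. card G = 3} = insert F ?P" using True by blast
    ultimately show ?thesis by simp
  qed
qed

text \<open>Facets are added in the order triangles, edges, vertices; the condition on disjoint
  edges ensures that some remaining facet edge always touches what is placed.\<close>

lemma shellable_if_shellable_triangles:
  assumes K: "simplicial_complex V K" and dim: "\<forall>F\<in>K. card F \<le> 3"
    and tri: "shellable_set {F \<in> K. card F = 3}"
    and edges: "\<And>e e'. e \<in> K \<Longrightarrow> e' \<in> K \<Longrightarrow> card e = 2 \<Longrightarrow> card e' = 2 \<Longrightarrow> e \<inter> e' = {}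
      \<Longrightarrow> \<exists>x\<in>e. \<exists>y\<in>e'. {x, y} \<in> K"
  shows "shellable K"
proof -
  let ?T = "{F \<in> K. card F = 3}" and ?E = "{F \<in> facets K. card F = 2}"
  have fin: "finite K" "finite F" if "F \<in> K" for F
    using simplicial_complex_finite[OF K] that by auto
  have sub: "G \<in> K" if "F \<in> K" "G \<subseteq> F" for F G
    using K that unfolding simplicial_complex_def by blast
  have "{} \<in> K" using K unfolding simplicial_complex_def by blast
  note finK = fin(1)[OF this]
  have T: "?T \<subseteq> facets K"
  proof
    fix F assume F: "F \<in> ?T"
    have "G = F" if "G \<in> K" "F \<subseteq> G" for G
      using that F dim fin(2)[OF that(1)] card_seteq[of G F] by auto
    thus "F \<in> facets K" using F by (auto simp: facets_def)
  qed
  have "shellable_set (?T \<union> ?E)"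
  proof (rule shellable_set_extend[OF _ tri])
    show "finite ?E" using finK by (auto simp: facets_def)
    fix S assume S: "?T \<subseteq> S" "S \<subset> ?T \<union> ?E"
    have SK: "S \<subseteq> facets K" using S T by blast
    \<comment> \<open>By incomparability of facets, \<open>e\<close> meets each facet of
      \<open>S\<close> in at most one vertex; a single covered endpoint therefore suffices.\<close>
    have attach: "attaches S e" if e: "e \<in> ?E" "e \<notin> S" and x: "x \<in> e" "x \<in> \<Union>S" for e x
      unfolding attaches_def
    proof
      have one: "\<exists>y. G \<inter> e = {y}" if "G \<in> S" "y \<in> G" "y \<in> e" for G y
      proof -
        have "\<not> e \<subseteq> G" using facets_not_subset[of e K G] e that SK by blast
        moreover obtain a b where "e = {a, b}" using e by (auto simp: card_2_iff)
        ultimately show ?thesis using that by blast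
      qed
      fix G assume G: "G \<in> S"
      show "\<exists>G'\<in>S. G \<inter> e \<subseteq> G' \<and> Suc (card (G' \<inter> e)) = card e"
      proof (cases "G \<inter> e = {}")
        case True
        obtain G' where "G' \<in> S" "x \<in> G'" using x by blast
        moreover from this obtain y where "G' \<inter> e = {y}" using one x by blast
        ultimately show ?thesis using True e by (intro bexI[of _ G']) auto
      next
        case False
        then obtain y where "G \<inter> e = {y}" using one[OF G] by blast
        thus ?thesis using G e by (intro bexI[of _ G]) auto
      qed
    qed
    obtain e where e: "e \<in> ?E" "e \<notin> S" using S by blast
    show "\<exists>F\<in>?T \<union> ?E - S. attaches S F"
    proof (cases "S = {} \<or> e \<inter> \<Union>S \<noteq> {}")
      case True
      hence "attaches S e" using attach e by (auto simp: attaches_def)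
      thus ?thesis using e by blast
    next
      case False
      then obtain G where G: "G \<in> S" by blast
      hence "card G = 3 \<or> card G = 2" "G \<in> K" using S by (auto simp: facets_def)
      then obtain a b where ab: "a \<in> G" "b \<in> G" "a \<noteq> b"
        by (auto simp: card_2_iff card_3_iff)
      have "e \<in> K" "card e = 2" using e by (auto simp: facets_def)
      moreover have "{a, b} \<in> K" "card {a, b} = 2" using sub[OF \<open>G \<in> K\<close>] ab by auto
      moreover have "{a, b} \<inter> e = {}" using False G ab by blast
      ultimately obtain x y where xy: "x \<in> {a, b}" "y \<in> e" "{x, y} \<in> K"
        using edges[of "{a, b}" e] by blast
      have y: "y \<notin> \<Union>S" "x \<in> \<Union>S" using False G ab xy by auto
      hence "x \<noteq> y" by blast
      \<comment> \<open>The facet above the connecting edge is missing because it contains the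
        uncovered \<open>y\<close>. All triangles are placed, so it is a facet edge, and it touches
        \<open>S\<close> at \<open>x\<close>.\<close>
      obtain F where F: "F \<in> facets K" "{x, y} \<subseteq> F" using facet_above[OF finK xy(3)] .
      have FK: "F \<in> K" using F by (simp add: facets_def)
      have "F \<notin> S" using F y by blast
      moreover have "card {x, y} \<le> card F" using F fin(2)[OF FK] by (intro card_mono)
      moreover have "card F \<le> 3" using dim FK by blast
      moreover have "card F \<noteq> 3" using \<open>F \<notin> S\<close> S FK by blast
      ultimately have "F \<in> ?E" using F \<open>x \<noteq> y\<close> by auto
      moreover have "attaches S F" using attach[OF \<open>F \<in> ?E\<close> \<open>F \<notin> S\<close>, of x] F y by blast
      ultimately show ?thesis using \<open>F \<notin> S\<close> by blast
    qed
  qed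
  hence "shellable_set ((?T \<union> ?E) \<union> facets K)"
  proof (rule shellable_set_extend[rotated])
    show "finite (facets K)" using finK by (auto simp: facets_def)
    fix S assume S: "?T \<union> ?E \<subseteq> S" "S \<subset> ?T \<union> ?E \<union> facets K"
    then obtain F where F: "F \<in> facets K" "F \<notin> S" using T by blast
    have SK: "S \<subseteq> facets K" using S T by blast
    have FK: "F \<in> K" using F by (simp add: facets_def)
    have "card F \<le> 3" "card F \<noteq> 3" "card F \<noteq> 2" using dim FK F S by auto
    hence "card F = 0 \<or> card F = 1" by linarith
    \<comment> \<open>An isolated vertex shares only the empty face, which has codimension one in
      it.\<close>
    have "attaches S F"
      unfolding attaches_def
    proof
      fix G assume G: "G \<in> S"
      have "\<not> F \<subseteq> G" using facets_not_subset[of F K G] F G SK by blast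
      hence "F \<noteq> {}" by blast
      hence "card F = 1" using \<open>card F = 0 \<or> card F = 1\<close> fin(2)[OF FK] by auto
      moreover from this have "G \<inter> F = {}" using \<open>\<not> F \<subseteq> G\<close> by (auto simp: card_1_singleton_iff)
      ultimately show "\<exists>G'\<in>S. G \<inter> F \<subseteq> G' \<and> Suc (card (G' \<inter> F)) = card F"
        using G by (intro bexI[of _ G]) auto
    qed
    thus "\<exists>F\<in>?T \<union> ?E \<union> facets K - S. attaches S F" using F by blast
  qed
  moreover have "(?T \<union> ?E) \<union> facets K = facets K" using T by blast
  ultimately show ?thesis using shellable_iff_shellable_set[OF K] by simp
qed

text \<open>Whichever edge comes second shares only the empty face, one dimension too small.\<close>

lemma not_shellable_set_disjoint_edges:
  assumes "card e = 2" "card e' = 2" "e \<inter> e' = {}"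
  shows "\<not> shellable_set {e, e'}"
proof
  assume "shellable_set {e, e'}"
  then obtain P F where PF: "{e, e'} = insert F P" "F \<notin> P" "attaches P F"
    by (cases rule: shellable_set.cases) auto
  have "e \<noteq> e'" using assms by auto
  moreover have "F = e \<or> F = e'" "P = {e, e'} - {F}" using PF(1,2) by auto
  ultimately have "F = e \<and> P = {e'} \<or> F = e' \<and> P = {e}" by auto
  thus False using PF(3) assms by (auto simp: attaches_def Int_commute)
qed

theorem corollary4:
  fixes V :: "'a set" and K :: "'a set set"
  assumes "simplicial_complex V K"
    and "complex_dim K = 2"
    and "\<not> shellable K"
  shows "\<exists>n::nat. 4 \<le> n \<and> n \<le> 7 \<and>
           (\<exists>U. U \<subseteq> V \<and> card U = n \<and> \<not> shellable (induced_subcomplex K U))"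
proof (rule ccontr)
  note K = assms(1)
  assume "\<not> ?thesis"
  hence "shellable (induced_subcomplex K U)" if "U \<subseteq> V" "4 \<le> card U" "card U \<le> 7" for U
    using that by blast
  hence ind: "shellable_set (facets (induced_subcomplex K U))"
    if "U \<subseteq> V" "4 \<le> card U" "card U \<le> 7" for U
    using that shellable_iff_shellable_set[OF simplicial_complex_induced[OF K]] by blast
  have fin: "finite F" if "F \<in> K" for F using simplicial_complex_finite(3)[OF K] that .
  have sub: "G \<in> K" if "F \<in> K" "G \<subseteq> F" for F G
    using K that unfolding simplicial_complex_def by blast
  have "K \<subseteq> Pow V" using K by (simp add: simplicial_complex_def)
  hence KV: "F \<subseteq> V" if "F \<in> K" for F using that by blast
  have dim: "\<forall>F\<in>K. card F \<le> 3"
  proof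
    fix F assume "F \<in> K"
    hence "face_dim F \<le> complex_dim K"
      unfolding complex_dim_def using simplicial_complex_finite(2)[OF K] by simp
    thus "card F \<le> 3" using assms(2) by (simp add: face_dim_def)
  qed
  let ?T = "{F \<in> K. card F = 3}"
  have "shellable_set ?T"
  proof (rule shellable_set_if_locally_shellable)
    show "finite ?T" using simplicial_complex_finite(2)[OF K] by simp
    show "\<forall>F\<in>?T. card F = 3" by blast
    fix U :: "'a set" assume U: "finite U" "card U \<le> 7"
    let ?W = "U \<inter> V" and ?TU = "{F \<in> ?T. F \<subseteq> U}"
    have finW: "finite ?W" using U by blast
    have TW: "F \<subseteq> ?W" if "F \<in> ?TU" for F using that KV by blast
    show "shellable_set ?TU"
    proof (cases "4 \<le> card ?W")
      case True
      let ?I = "induced_subcomplex K ?W"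
      have "card ?W \<le> 7" using U card_mono[of U ?W] by simp
      hence "shellable_set (facets ?I)" using True by (intro ind) auto
      hence "shellable_set {F \<in> facets ?I. card F = 3}"
        by (rule shellable_set_triangles) (use dim fin in \<open>auto simp: induced_subcomplex_def\<close>)
      moreover have "{F \<in> facets ?I. card F = 3} = ?TU"
      proof
        show "{F \<in> facets ?I. card F = 3} \<subseteq> ?TU" by (auto simp: facets_def induced_subcomplex_def)
        show "?TU \<subseteq> {F \<in> facets ?I. card F = 3}"
        proof
          fix F assume F: "F \<in> ?TU"
          have "G = F" if "G \<in> ?I" "F \<subseteq> G" for G
          proof -
            have "G \<in> K" using that by (simp add: induced_subcomplex_def)
            thus ?thesis using that F dim fin[of G] card_seteq[of G F] by auto
          qed
          moreover have "F \<in> ?I" using TW[OF F] F by (simp add: induced_subcomplex_def)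
          ultimately show "F \<in> {F \<in> facets ?I. card F = 3}" using F by (auto simp: facets_def)
        qed
      qed
      ultimately show ?thesis by simp
    next
      case False
      \<comment> \<open>Fewer than four vertices leave room for at most one triangle, so the induced
        subcomplexes are not consulted.\<close>
      have "F = ?W" if "F \<in> ?TU" for F
        using card_seteq[OF finW TW[OF that]] False that by simp
      hence "?TU \<subseteq> {?W}" by blast
      from subset_singletonD[OF this] show ?thesis
      proof
        assume "?TU = {}"
        thus ?thesis by (simp only: shellable_set.empty)
      next
        assume "?TU = {?W}"
        moreover have "shellable_set {?W}"
          using shellable_set.insert[OF shellable_set.empty, of ?W] by (simp add: attaches_def)
        ultimately show ?thesis by (simp only:)
      qed
    qed
  qed
  moreover have "\<exists>x\<in>e. \<exists>y\<in>e'. {x, y} \<in> K"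
    if e: "e \<in> K" "e' \<in> K" "card e = 2" "card e' = 2" "e \<inter> e' = {}" for e e'
  proof (rule ccontr)
    assume no: "\<not> ?thesis"
    let ?I = "induced_subcomplex K (e \<union> e')"
    have ne: "e \<noteq> {}" "e' \<noteq> {}" using e by auto
    have face: "F \<subseteq> e \<or> F \<subseteq> e'" if F: "F \<in> ?I" for F
    proof (rule ccontr)
      assume "\<not> ?thesis"
      then obtain x y where xy: "x \<in> F" "x \<notin> e'" "y \<in> F" "y \<notin> e" by blast
      hence "x \<in> e" "y \<in> e'" "F \<in> K" using F by (auto simp: induced_subcomplex_def)
      moreover from this have "{x, y} \<in> K" using sub[of F "{x, y}"] xy by blast
      ultimately show False using no by blast
    qed
    have eI: "e \<in> ?I" "e' \<in> ?I" using e by (auto simp: induced_subcomplex_def)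
    \<comment> \<open>Without a cross edge no face meets both edges, so the four vertices induce a
      nonshellable pair of disjoint edges.\<close>
    have "facets ?I = {e, e'}"
    proof
      show "facets ?I \<subseteq> {e, e'}"
      proof
        fix F assume "F \<in> facets ?I"
        hence F: "F \<in> ?I" "\<And>G. G \<in> ?I \<Longrightarrow> F \<subseteq> G \<Longrightarrow> G = F" by (auto simp: facets_def)
        show "F \<in> {e, e'}" using face[OF F(1)] F(2)[OF eI(1)] F(2)[OF eI(2)] by auto
      qed
      have "G = e" if "G \<in> ?I" "e \<subseteq> G" for G using face[OF that(1)] that(2) ne e(5) by blast
      moreover have "G = e'" if "G \<in> ?I" "e' \<subseteq> G" for G using face[OF that(1)] that(2) ne e(5) by blast
      ultimately show "{e, e'} \<subseteq> facets ?I" using eI unfolding facets_def by blast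
    qed
    moreover have "card (e \<union> e') = 4" using e fin by (subst card_Un_disjoint) auto
    moreover have "e \<union> e' \<subseteq> V" using KV e by blast
    ultimately have "shellable_set {e, e'}" using ind[of "e \<union> e'"] by simp
    thus False using not_shellable_set_disjoint_edges e by blast
  qed
  ultimately have "shellable K" by (rule shellable_if_shellable_triangles[OF K dim])
  thus False using assms(3) by blast
qed

end
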